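(* Let $\bm{y}\in\mathbb{R}^L$, $\lambda_1,\lambda_2>0$, $\bm{\Phi}_1=(\phi_{1,1},\dots,\phi_{1,L})\in\mathcal{A}^L$ and $\bm{\Phi}_2=(\phi_{2,1},\dots,\phi_{2,L})\in\mathcal{H}^L$. Consider the solution set $$\mathcal{W}(\lambda_1,\lambda_2):=\underset{(s_1,s_2)\in\mathcal{B}\times\mathcal{H}}{\arg\min}\ \frac12\|\bm{y}-(\bm{\Phi}_1(s_1)+\bm{\Phi}_2(s_2))\|_2^2+\lambda_1\|s_1\|_{\mathcal{B}}+\frac{\lambda_2}{2}\|s_2\|_{\mathcal{H}}^2.$$ Then $\mathcal{W}(\lambda_1,\lambda_2)$ is non-empty, convex, and weak*-compact in $\mathcal{B}\times\mathcal{H}$. Its extreme points are of the form $$(\widehat{s}_1,\widehat{s}_2)=\left(\sum_{1\le k\le K}\alpha_k e_k,\ \frac{1}{\lambda_2}\bm{\Phi}_2^*\mathbf{M}_{\lambda_2}^{-1}(\bm{y}-\bm{w})\right),$$ where $0\le K\le L$, $\alpha_k\in\mathbb{R}\setminus\{0\}$, the $e_k$ are distinct extreme points of the unit ball $\{s_1\in\mathcal{B}:\ \|s_1\|_{\mathcal{B}}\le 1\}$, and $\bm{w}=\bm{\Phi}_1(\widehat{s}_1)\in\mathbb{R}^L$ is a vector that is the same for all solutions $(\widehat{s}_1,\widehat{s}_2)\in\mathcal{W}(\lambda_1,\lambda_2)$.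
   Context: All spaces are real, and $L\ge 1$ is an integer. $(\mathcal{A},\|\cdot\|_{\mathcal{A}})$ is a Banach space and $\mathcal{B}=\mathcal{A}'$ is its topological dual with the dual norm $\|s\|_{\mathcal{B}}=\sup_{\|u\|_{\mathcal{A}}=1}\langle u,s\rangle_{\mathcal{A}\times\mathcal{B}}$, where $\langle u,s\rangle_{\mathcal{A}\times\mathcal{B}}=s(u)$. $\mathcal{H}$ is a Hilbert space with inner product $\langle\cdot,\cdot\rangle_{\mathcal{H}}$ and norm $\|\cdot\|_{\mathcal{H}}$, identified with its own dual. The weak*-topology on $\mathcal{B}\times\mathcal{H}$ is the one inherited from the predual $\mathcal{A}\times\mathcal{H}$ (product of the weak*-topology of $\mathcal{B}=\mathcal{A}'$ and the weak topology of $\mathcal{H}$). For $\bm{\Phi}_1\in\mathcal{A}^L$, the same symbol denotes the linear map $\bm{\Phi}_1:\mathcal{B}\to\mathbb{R}^L$, $\bm{\Phi}_1(s)=(\langle\phi_{1,\ell},s\rangle_{\mathcal{A}\times\mathcal{B}})_{1\le\ell\le L}$. For $\bm{\Phi}_2\in\mathcal{H}^L$, the same symbol denotes the linear map $\bm{\Phi}_2:\mathcal{H}\to\mathbb{R}^L$, $\bm{\Phi}_2(s)=(\langle\phi_{2,\ell},s\rangle_{\mathcal{H}})_{1\le\ell\le L}$, with adjoint $\bm{\Phi}_2^*:\mathbb{R}^L\to\mathcal{H}$, $\bm{\Phi}_2^*(\bm{h})=\sum_{\ell=1}^L h_\ell\,\phi_{2,\ell}$. The $L\times L$ matrix $$\mathbf{M}_{\lambda_2}:=\frac{1}{\lambda_2}\left(\bm{\Phi}_2\bm{\Phi}_2^*+\lambda_2\mathbf{I}_L\right)=\frac{1}{\lambda_2}\big(\langle\phi_{2,k},\phi_{2,\ell}\rangle_{\mathcal{H}}+\lambda_2\,\delta[k-\ell]\big)_{1\le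 k,\ell\le L}$$ is symmetric positive definite, hence invertible. An empty sum ($K=0$) equals $0$. *)

theory Defs
  imports "HOL-Analysis.Analysis"
begin

(* The dual of a real normed space 'a is the type of bounded linear functionals
   'a \<Rightarrow>\<^sub>L real with its operator norm.  For scalar-valued operators the strong operator
   topology is the topology of pointwise convergence on 'a, i.e. the weak-star topology. *)

definition weak_star_topology :: "('a::real_normed_vector \<Rightarrow>\<^sub>L real) topology"
  where "weak_star_topology = strong_operator_topology"

(* Initial topology for all continuous linear functionals: the type of functions
   ('h \<Rightarrow>\<^sub>L real) \<Rightarrow> real carries the product topology. *)

definition weak_topology :: "'h::real_normed_vector topology"
  where "weak_topology = pullback_topology UNIV (\<lambda>s (f :: 'h \<Rightarrow>\<^sub>L real). blinfun_apply f s) euclidean"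

definition dual_measurement ::
  "'a::real_normed_vector ^ 'l \<Rightarrow> ('a \<Rightarrow>\<^sub>L real) \<Rightarrow> real ^ 'l"
  where "dual_measurement \<phi> s = (\<chi> l. blinfun_apply s (\<phi> $ l))"

definition hilbert_measurement :: "'h::real_inner ^ 'l \<Rightarrow> 'h \<Rightarrow> real ^ 'l"
  where "hilbert_measurement \<phi> s = (\<chi> l. (\<phi> $ l) \<bullet> s)"

definition hilbert_measurement_adjoint :: "'h::real_inner ^ 'l \<Rightarrow> real ^ 'l \<Rightarrow> 'h"
  where "hilbert_measurement_adjoint \<phi> h = (\<Sum>l\<in>UNIV. (h $ l) *\<^sub>R (\<phi> $ l))"

definition regularized_gram :: "real \<Rightarrow> 'h::real_inner ^ 'l \<Rightarrow> real ^ 'l ^ 'l"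
  where "regularized_gram lam \<phi> =
    (1 / lam) *\<^sub>R ((\<chi> k l. (\<phi> $ k) \<bullet> (\<phi> $ l)) + lam *\<^sub>R mat 1)"

definition hybrid_objective ::
  "real ^ 'l \<Rightarrow> real \<Rightarrow> real \<Rightarrow> 'a::real_normed_vector ^ 'l \<Rightarrow> 'h::real_inner ^ 'l
    \<Rightarrow> ('a \<Rightarrow>\<^sub>L real) \<times> 'h \<Rightarrow> real"
  where "hybrid_objective y lam\<^sub>1 lam\<^sub>2 \<phi>\<^sub>1 \<phi>\<^sub>2 = (\<lambda>(s\<^sub>1, s\<^sub>2).
    1/2 * (norm (y - (dual_measurement \<phi>\<^sub>1 s\<^sub>1 + hilbert_measurement \<phi>\<^sub>2 s\<^sub>2)))\<^sup>2
      + lam\<^sub>1 * norm s\<^sub>1 + lam\<^sub>2 / 2 * (norm s\<^sub>2)\<^sup>2)"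

definition hybrid_solutions ::
  "real ^ 'l \<Rightarrow> real \<Rightarrow> real \<Rightarrow> 'a::real_normed_vector ^ 'l \<Rightarrow> 'h::real_inner ^ 'l
    \<Rightarrow> (('a \<Rightarrow>\<^sub>L real) \<times> 'h) set"
  where "hybrid_solutions y lam\<^sub>1 lam\<^sub>2 \<phi>\<^sub>1 \<phi>\<^sub>2 =
    {p. is_arg_min (hybrid_objective y lam\<^sub>1 lam\<^sub>2 \<phi>\<^sub>1 \<phi>\<^sub>2) (\<lambda>_. True) p}"

end

theory Submission
  imports Defs
begin

text \<open>
  Completing the square in the second variable writes the objective as
  \<open>F s\<^sub>1 + 1/2 * (norm (\<Phi>\<^sub>2 h))\<^sup>2 + lam\<^sub>2/2 * (norm h)\<^sup>2\<close>, where \<open>h\<close> is the deviation of \<open>s\<^sub>2\<close> from the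
  ridge regression solution for the residual \<open>y - \<Phi>\<^sub>1 s\<^sub>1\<close>, and
  \<open>F s\<^sub>1 = Q (y - \<Phi>\<^sub>1 s\<^sub>1) + lam\<^sub>1 * norm s\<^sub>1\<close> with \<open>Q\<close> a positive definite quadratic form. Sublevel sets
  of \<open>F\<close> are weak-star compact by Tychonoff's theorem, and strict convexity of \<open>Q\<close> makes \<open>w = \<Phi>\<^sub>1 s\<^sub>1\<close>
  the same for all minimizers. Hence the solution set is
  \<open>{s. \<Phi>\<^sub>1 s = w \<and> norm s \<le> r} \<times> {s\<^sub>2}\<close> with \<open>r\<close> the smallest norm compatible with \<open>w\<close>. At an
  extreme point of the first factor, \<open>\<Phi>\<^sub>1\<close> is injective on the directions of the face of the ball
  containing it, and by minimality of \<open>r\<close> its image misses \<open>w\<close>. So this face has dimension below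
  the number of measurements, and Caratheodory's argument represents the point by as many extreme
  points of the ball as there are measurements.
\<close>


subsection \<open>Extreme points of bounded closed convex sets\<close>

text \<open>The linear space parallel to the smallest face of \<open>S\<close> containing \<open>x\<close>.\<close>

definition face_directions :: "'v::real_vector set \<Rightarrow> 'v \<Rightarrow> 'v set"
  where "face_directions S x = {v. \<exists>\<epsilon>>0. x + \<epsilon> *\<^sub>R v \<in> S \<and> x - \<epsilon> *\<^sub>R v \<in> S}"

lemma subspace_face_directions:
  assumes "convex S" and "x \<in> S"
  shows "subspace (face_directions S x)"
proof (rule subspaceI)
  show "0 \<in> face_directions S x"
    using \<open>x \<in> S\<close> by (auto simp: face_directions_def intro!: exI[of _ 1])
next
  fix v w assume "v \<in> face_directions S x" "w \<in> face_directions S x"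
  then obtain a b where a: "a > 0" "x + a *\<^sub>R v \<in> S" "x - a *\<^sub>R v \<in> S"
    and b: "b > 0" "x + b *\<^sub>R w \<in> S" "x - b *\<^sub>R w \<in> S"
    by (auto simp: face_directions_def)
  \<comment> \<open>The weights shrink both steps to the common length
    \<open>a * b / (a + b)\<close>, which is then a valid step for \<open>v + w\<close>.\<close>
  define t where "t = b / (a + b)"
  define u where "u = a / (a + b)"
  have tu: "t \<ge> 0" "u \<ge> 0" "t + u = 1" and ta: "t * a = a * b / (a + b)" "u * b = a * b / (a + b)"
    using a(1) b(1) by (auto simp: t_def u_def add_divide_distrib[symmetric] add_pos_pos[THEN less_imp_neq[THEN not_sym]] algebra_simps)
  have x: "t *\<^sub>R x + u *\<^sub>R x = x"
    using tu(3) by (metis scaleR_left.add scaleR_one)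
  have "t *\<^sub>R (x + a *\<^sub>R v) + u *\<^sub>R (x + b *\<^sub>R w) \<in> S"
    "t *\<^sub>R (x - a *\<^sub>R v) + u *\<^sub>R (x - b *\<^sub>R w) \<in> S"
    using a b tu \<open>convex S\<close> by (auto intro: convexD)
  moreover have "t *\<^sub>R (x + a *\<^sub>R v) + u *\<^sub>R (x + b *\<^sub>R w) = x + (a * b / (a + b)) *\<^sub>R (v + w)"
    "t *\<^sub>R (x - a *\<^sub>R v) + u *\<^sub>R (x - b *\<^sub>R w) = x - (a * b / (a + b)) *\<^sub>R (v + w)"
    by (subst (3) x[symmetric], simp add: scaleR_right_distrib scaleR_right_diff_distrib ta)+
  moreover have "a * b / (a + b) > 0"
    using a b by simp
  ultimately show "v + w \<in> face_directions S x"
    unfolding face_directions_def by auto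
next
  fix c v assume "v \<in> face_directions S x"
  then obtain a where a: "a > 0" "x + a *\<^sub>R v \<in> S" "x - a *\<^sub>R v \<in> S"
    by (auto simp: face_directions_def)
  show "c *\<^sub>R v \<in> face_directions S x"
  proof (cases "c = 0")
    case True
    then show ?thesis
      using \<open>x \<in> S\<close> by (auto simp: face_directions_def intro!: exI[of _ 1])
  next
    case False
    have "(a / \<bar>c\<bar>) * c = a \<or> (a / \<bar>c\<bar>) * c = - a"
      using False by (auto simp: abs_if)
    moreover have "a / \<bar>c\<bar> > 0"
      using False a by simp
    ultimately show ?thesis
      using a unfolding face_directions_def by (auto intro!: exI[of _ "a / \<bar>c\<bar>"])
  qed
qed

text \<open>Shrinking \<open>S\<close> towards \<open>b\<close> by the factor \<open>1 - t\<close>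
  carries a segment around \<open>a\<close> to one around the new point, with the same direction
  and, as \<open>t < 1\<close>, positive length.\<close>

lemma face_directions_mono:
  assumes "convex S" and "b \<in> S" and "0 \<le> t" "t < 1"
  shows "face_directions S a \<subseteq> face_directions S ((1 - t) *\<^sub>R a + t *\<^sub>R b)"
proof
  fix v assume "v \<in> face_directions S a"
  then obtain e where e: "e > 0" "a + e *\<^sub>R v \<in> S" "a - e *\<^sub>R v \<in> S"
    by (auto simp: face_directions_def)
  then have "(1 - t) *\<^sub>R (a + e *\<^sub>R v) + t *\<^sub>R b \<in> S" "(1 - t) *\<^sub>R (a - e *\<^sub>R v) + t *\<^sub>R b \<in> S"
    using assms by (auto intro: convexD)
  then show "v \<in> face_directions S ((1 - t) *\<^sub>R a + t *\<^sub>R b)"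
    using e assms unfolding face_directions_def
    by (auto intro!: exI[of _ "(1 - t) * e"] simp: algebra_simps)
qed

lemma extreme_point_ofI_face_directions:
  assumes "x \<in> S" and "convex S" and "face_directions S x \<subseteq> {0}"
  shows "x extreme_point_of S"
  unfolding extreme_point_of_def
proof (intro conjI ballI notI)
  fix a b assume ab: "a \<in> S" "b \<in> S" "x \<in> open_segment a b"
  then obtain u where u: "a \<noteq> b" "0 < u" "u < 1" "x = (1 - u) *\<^sub>R a + u *\<^sub>R b"
    by (auto simp: in_segment)
  define e where "e = min u (1 - u)"
  have e: "e > 0" "e \<le> u" "e \<le> 1 - u"
    using u by (auto simp: e_def)
  have "(1 - (u + e)) *\<^sub>R a + (u + e) *\<^sub>R b \<in> S" "(1 - (u - e)) *\<^sub>R a + (u - e) *\<^sub>R b \<in> S"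
    using ab e u \<open>convex S\<close> by (auto intro: convexD)
  then have "b - a \<in> face_directions S x"
    using e unfolding face_directions_def u(4)
    by (auto intro!: exI[of _ e] simp: algebra_simps)
  then show False
    using assms u by auto
qed (use assms in auto)

text \<open>The last point of \<open>S\<close> on the ray from \<open>x\<close> along
  \<open>v\<close> can no longer move along \<open>v\<close>, and no direction is gained on the way.
  This strict drop drives both inductions on dimension below.\<close>

lemma face_directions_exit:
  fixes S :: "'v::real_normed_vector set"
  assumes "convex S" "closed S" "bounded S" and "x \<in> S"
    and "v \<in> face_directions S x" and "v \<noteq> 0"
  obtains t where "t \<ge> 0" and "x + t *\<^sub>R v \<in> S"
    and "face_directions S (x + t *\<^sub>R v) \<subset> face_directions S x"
proof -
  obtain e where e: "e > 0" "x - e *\<^sub>R v \<in> S"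
    using assms by (auto simp: face_directions_def)
  define T where "T = (\<lambda>t. x + t *\<^sub>R v) -` S"
  have "closed T"
    unfolding T_def by (intro closed_vimage \<open>closed S\<close> continuous_intros)
  moreover have "bounded T"
  proof -
    obtain B where B: "\<And>z. z \<in> S \<Longrightarrow> norm z \<le> B"
      using \<open>bounded S\<close> by (auto simp: bounded_iff)
    have "norm t \<le> (B + norm x) / norm v" if "t \<in> T" for t
    proof -
      have "norm (t *\<^sub>R v) \<le> norm (x + t *\<^sub>R v) + norm x"
        using norm_triangle_ineq4[of "x + t *\<^sub>R v" x] by simp
      also have "\<dots> \<le> B + norm x"
        using B that by (auto simp: T_def)
      finally show ?thesis
        using \<open>v \<noteq> 0\<close> by (simp add: field_simps)
    qed
    then show ?thesis
      by (auto simp: bounded_iff)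
  qed
  ultimately have "compact T"
    by (simp add: compact_eq_bounded_closed)
  moreover have "0 \<in> T"
    using \<open>x \<in> S\<close> by (simp add: T_def)
  ultimately obtain t where t: "t \<in> T" "\<And>u. u \<in> T \<Longrightarrow> u \<le> t"
    using compact_attains_sup[of T] by blast
  have "t \<ge> 0"
    using t \<open>0 \<in> T\<close> by auto
  have "v \<notin> face_directions S (x + t *\<^sub>R v)"
  proof
    assume "v \<in> face_directions S (x + t *\<^sub>R v)"
    then obtain d where "d > 0" "x + t *\<^sub>R v + d *\<^sub>R v \<in> S"
      by (auto simp: face_directions_def)
    then have "t + d \<in> T"
      by (simp add: T_def algebra_simps)
    then show False
      using t(2) \<open>d > 0\<close> by fastforce
  qed
  moreover have "face_directions S (x + t *\<^sub>R v) \<subseteq> face_directions S x"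
  proof -
    \<comment> \<open>\<open>x\<close> lies between the exit point and
      \<open>x - e *\<^sub>R v\<close>, a point of \<open>S\<close>. The weight of the latter is
      below 1 because \<open>e > 0\<close>, so \<open>face_directions_mono\<close> applies.\<close>
    have "x = (1 - t / (t + e)) *\<^sub>R (x + t *\<^sub>R v) + (t / (t + e)) *\<^sub>R (x - e *\<^sub>R v)"
    proof -
      have "(1 - t / (t + e)) *\<^sub>R (x + t *\<^sub>R v) + (t / (t + e)) *\<^sub>R (x - e *\<^sub>R v)
          = x + ((1 - t / (t + e)) * t - t / (t + e) * e) *\<^sub>R v"
        by (simp add: algebra_simps)
      moreover have "(1 - t / (t + e)) * t - t / (t + e) * e = 0"
        using e \<open>t \<ge> 0\<close> by (simp add: field_simps)
      ultimately show ?thesis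
        by simp
    qed
    then show ?thesis
      using face_directions_mono[OF \<open>convex S\<close> e(2), of "t / (t + e)" "x + t *\<^sub>R v"] e \<open>t \<ge> 0\<close>
      by simp
  qed
  ultimately show thesis
    using that[of t] t \<open>t \<ge> 0\<close> assms(5) by (auto simp: T_def)
qed

lemma dim_face_directions_less:
  fixes f :: "'v::real_normed_vector \<Rightarrow> 'b::euclidean_space"
  assumes "linear f" "inj_on f (face_directions S x)" "convex S" "x \<in> S" "y \<in> S"
    and "face_directions S y \<subset> face_directions S x"
  shows "dim (f ` face_directions S y) < dim (f ` face_directions S x)"
proof (rule dim_psubset)
  have "f ` face_directions S y \<subset> f ` face_directions S x"
    using assms by (metis inj_on_image_eq_iff image_mono psubset_eq subset_refl)
  moreover have "subspace (f ` face_directions S z)" if "z \<in> S" for z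
    using assms(1,3) that by (intro linear_subspace_image subspace_face_directions)
  ultimately show "span (f ` face_directions S y) \<subset> span (f ` face_directions S x)"
    using assms(4,5) by (metis span_eq_iff)
qed

text \<open>
  The face may live in an infinite-dimensional space, so its dimension is measured through a linear
  map \<open>f\<close> into a Euclidean space that is injective on the face directions.
\<close>

lemma extreme_point_in_face_exists:
  fixes f :: "'v::real_normed_vector \<Rightarrow> 'b::euclidean_space"
  assumes S: "convex S" "closed S" "bounded S" and f: "linear f"
    and "x \<in> S" and "inj_on f (face_directions S x)"
  shows "\<exists>e. e extreme_point_of S \<and> x - e \<in> face_directions S x"
  using assms(5,6)
proof (induction "dim (f ` face_directions S x)" arbitrary: x rule: less_induct)
  case less
  note sub = subspace_face_directions[OF S(1) less.prems(1)]
  show ?case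
  proof (cases "face_directions S x \<subseteq> {0}")
    case True
    then show ?thesis
      using extreme_point_ofI_face_directions[OF less.prems(1) S(1)] subspace_0[OF sub]
      by (intro exI[of _ x]) simp
  next
    case False
    then obtain v where v: "v \<in> face_directions S x" "v \<noteq> 0"
      by auto
    then obtain t where t: "x + t *\<^sub>R v \<in> S"
      "face_directions S (x + t *\<^sub>R v) \<subset> face_directions S x"
      using face_directions_exit[OF S less.prems(1)] by metis
    have "\<exists>e. e extreme_point_of S \<and> x + t *\<^sub>R v - e \<in> face_directions S (x + t *\<^sub>R v)"
      using less.prems t
      by (intro less.hyps dim_face_directions_less[OF f] S inj_on_subset[OF less.prems(2)]) auto
    then obtain e where e: "e extreme_point_of S" "x + t *\<^sub>R v - e \<in> face_directions S x"
      using t by blast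
    have "(x + t *\<^sub>R v - e) - t *\<^sub>R v \<in> face_directions S x"
      by (rule subspace_diff[OF sub e(2) subspace_scale[OF sub v(1)]])
    then show ?thesis
      using e by (intro exI[of _ e]) (simp add: algebra_simps)
  qed
qed

text \<open>Caratheodory's argument: prolong the segment from an extreme point \<open>e\<close> of
  the face through \<open>x\<close> until it leaves \<open>S\<close> at \<open>y\<close>. Then
  \<open>x\<close> lies between \<open>e\<close> and \<open>y\<close>, and the face of
  \<open>y\<close> has lower dimension, which pays for the extra point \<open>e\<close>.\<close>

lemma convex_hull_extreme_points_face_dim:
  fixes f :: "'v::real_normed_vector \<Rightarrow> 'b::euclidean_space"
  assumes S: "convex S" "closed S" "bounded S" and f: "linear f"
    and "x \<in> S" and "inj_on f (face_directions S x)"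
  shows "\<exists>P. finite P \<and> card P \<le> dim (f ` face_directions S x) + 1
    \<and> (\<forall>p\<in>P. p extreme_point_of S) \<and> x \<in> convex hull P"
  using assms(5,6)
proof (induction "dim (f ` face_directions S x)" arbitrary: x rule: less_induct)
  case less
  note sub = subspace_face_directions[OF S(1) less.prems(1)]
  obtain e where e: "e extreme_point_of S" "x - e \<in> face_directions S x"
    using extreme_point_in_face_exists[OF S f less.prems] by blast
  show ?case
  proof (cases "x = e")
    case True
    then show ?thesis
      using e by (intro exI[of _ "{x}"]) auto
  next
    case False
    then obtain t where t: "t \<ge> 0" "x + t *\<^sub>R (x - e) \<in> S"
      "face_directions S (x + t *\<^sub>R (x - e)) \<subset> face_directions S x"
      using face_directions_exit[OF S less.prems(1) e(2)] by auto
    define y where "y = x + t *\<^sub>R (x - e)"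
    have y: "y \<in> S" "face_directions S y \<subset> face_directions S x"
      using t by (auto simp: y_def)
    have dim: "dim (f ` face_directions S y) < dim (f ` face_directions S x)"
      using less.prems y by (intro dim_face_directions_less[OF f] S) auto
    obtain P where P: "finite P" "card P \<le> dim (f ` face_directions S y) + 1"
      "\<And>p. p \<in> P \<Longrightarrow> p extreme_point_of S" "y \<in> convex hull P"
      using less.hyps[OF dim y(1)] inj_on_subset[OF less.prems(2)] y by blast
    have "x = (1 / (1 + t)) *\<^sub>R y + (t / (1 + t)) *\<^sub>R e"
    proof -
      have "y = (1 + t) *\<^sub>R x - t *\<^sub>R e"
        by (simp add: y_def algebra_simps)
      then show ?thesis
        using t by (simp add: scaleR_right_diff_distrib)
    qed
    moreover have "y \<in> convex hull insert e P" "e \<in> convex hull insert e P"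
      using P(4) hull_mono[of P "insert e P"] by (auto intro: hull_inc)
    moreover have "1 / (1 + t) + t / (1 + t) = 1"
      using t by (simp add: add_divide_distrib[symmetric])
    ultimately have "x \<in> convex hull insert e P"
      using t convexD[OF convex_convex_hull] by (metis add_nonneg_nonneg divide_nonneg_nonneg zero_le_one)
    moreover have "card (insert e P) \<le> dim (f ` face_directions S x) + 1"
      using dim P(1,2) card_insert_le_m1[of "dim (f ` face_directions S x) + 1" P e] by auto
    ultimately show ?thesis
      using P e by (intro exI[of _ "insert e P"]) auto
  qed
qed

text \<open>Caratheodory alone would allow \<open>DIM('b) + 1\<close> points. For
  \<open>r > 0\<close>, minimality of \<open>r\<close> saves one, since the face directions map onto
  a subspace that misses \<open>w\<close>; extremality of \<open>s\<close> makes this map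
  injective.\<close>

lemma extreme_point_of_minimal_norm_set:
  fixes f :: "'v::real_normed_vector \<Rightarrow> 'b::euclidean_space"
  assumes f: "linear f"
    and s: "s extreme_point_of {s. f s = w \<and> norm s \<le> r}"
    and min: "\<And>s. f s = w \<Longrightarrow> r \<le> norm s"
  obtains K :: nat and \<alpha> :: "nat \<Rightarrow> real" and e :: "nat \<Rightarrow> 'v"
  where "K \<le> DIM('b)"
    and "\<And>k. k \<in> {1..K} \<Longrightarrow> \<alpha> k \<noteq> 0 \<and> e k extreme_point_of {s. norm s \<le> 1}"
    and "inj_on e {1..K}" and "s = (\<Sum>k=1..K. \<alpha> k *\<^sub>R e k)"
proof (cases "r = 0")
  case True
  then have "s = 0"
    using s by (simp add: extreme_point_of_def)
  \<comment> \<open>The empty sum, \<open>K = 0\<close>: the norm bound leaves only the zero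
    vector.\<close>
  then show thesis
    using that[of 0] by simp
next
  case False
  have fs: "f s = w" and ns: "norm s = r"
    using s min[of s] by (auto simp: extreme_point_of_def)
  then have r: "r > 0"
    using False norm_ge_zero[of s] by linarith
  define B where "B = {s::'v. norm s \<le> 1}"
  have B: "B = cball 0 1"
    by (auto simp: B_def)
  define x where "x = s /\<^sub>R r"
  have xB: "x \<in> B" and sx: "s = r *\<^sub>R x"
    using r ns by (simp_all add: B_def x_def)
  define D where "D = face_directions B x"
  have D: "subspace D"
    unfolding D_def using xB by (intro subspace_face_directions) (simp_all add: B)
  have shift: "norm (s + (r * \<epsilon>) *\<^sub>R v) \<le> r" if "x + \<epsilon> *\<^sub>R v \<in> B" for v \<epsilon>
  proof -
    have "s + (r * \<epsilon>) *\<^sub>R v = r *\<^sub>R (x + \<epsilon> *\<^sub>R v)"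
      by (simp add: sx algebra_simps)
    then show ?thesis
      using that r by (simp add: B_def)
  qed
  have inj: "inj_on f D"
  proof (subst linear_inj_on_iff_eq_0[OF f D], safe)
    fix v assume "v \<in> D" "f v = 0"
    then obtain \<epsilon> where e: "\<epsilon> > 0" "x + \<epsilon> *\<^sub>R v \<in> B" "x + (-\<epsilon>) *\<^sub>R v \<in> B"
      by (auto simp: D_def face_directions_def)
    \<comment> \<open>Two opposite moves inside the kernel of \<open>f\<close> stay in the slice and
      have \<open>s\<close> as midpoint, so extremality forces them to coincide.\<close>
    define a b where "a = s + (r * \<epsilon>) *\<^sub>R v" and "b = s + (r * -\<epsilon>) *\<^sub>R v"
    have "a \<in> {s. f s = w \<and> norm s \<le> r}" "b \<in> {s. f s = w \<and> norm s \<le> r}"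
      using shift[OF e(2)] shift[OF e(3)] \<open>f v = 0\<close> fs
      by (auto simp: a_def b_def linear_add[OF f] linear_cmul[OF f] linear_diff[OF f])
    moreover have "s = midpoint a b"
      by (simp add: midpoint_def a_def b_def algebra_simps scaleR_2[symmetric])
    ultimately have "a = b"
      using s midpoint_in_open_segment unfolding extreme_point_of_def by blast
    then have "(2 * r * \<epsilon>) *\<^sub>R v = 0"
      by (simp add: a_def b_def algebra_simps scaleR_2[symmetric])
    then show "v = 0"
      using r e by simp
  qed
  have "w \<notin> f ` D"
    \<comment> \<open>Otherwise moving inside the face and rescaling would meet the constraint with a smaller norm.\<close>
  proof
    assume "w \<in> f ` D"
    then obtain v \<epsilon> where v: "f v = w" "\<epsilon> > 0" "x + \<epsilon> *\<^sub>R v \<in> B"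
      by (auto simp: D_def face_directions_def)
    define \<eta> where "\<eta> = r * \<epsilon>"
    have \<eta>: "\<eta> > 0" "norm (s + \<eta> *\<^sub>R v) \<le> r"
      using v r shift by (auto simp: \<eta>_def)
    have "w + \<eta> *\<^sub>R w = (1 + \<eta>) *\<^sub>R w"
      by (simp add: scaleR_left_distrib)
    then have "f ((1 / (1 + \<eta>)) *\<^sub>R (s + \<eta> *\<^sub>R v)) = (1 / (1 + \<eta>)) *\<^sub>R ((1 + \<eta>) *\<^sub>R w)"
      by (simp only: linear_add[OF f] linear_cmul[OF f] fs v)
    then have "r \<le> norm ((1 / (1 + \<eta>)) *\<^sub>R (s + \<eta> *\<^sub>R v))"
      using \<eta> by (intro min) simp
    also have "\<dots> = norm (s + \<eta> *\<^sub>R v) / (1 + \<eta>)"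
      using \<eta> by simp
    also have "\<dots> \<le> r / (1 + \<eta>)"
      using \<eta> by (intro divide_right_mono) auto
    also have "\<dots> < r"
      using \<eta> r by (simp add: field_simps)
    finally show False
      by simp
  qed
  then have "span (f ` D) \<noteq> UNIV"
    using linear_subspace_image[OF f D] by (metis UNIV_I span_eq_iff)
  then have "dim (f ` D) < DIM('b)"
    using dim_eq_full[of "f ` D"] dim_subset_UNIV[of "f ` D"] by linarith
  moreover obtain P where P: "finite P" "card P \<le> dim (f ` D) + 1"
    "\<And>p. p \<in> P \<Longrightarrow> p extreme_point_of B" "x \<in> convex hull P"
    using convex_hull_extreme_points_face_dim[OF _ _ _ f xB] inj by (auto simp: B D_def)
  ultimately have cardP: "card P \<le> DIM('b)"
    by simp
  obtain u where u: "sum u P = 1" "(\<Sum>p\<in>P. u p *\<^sub>R p) = x"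
    using P(4) by (auto simp: convex_hull_finite[OF P(1)])
  \<comment> \<open>Dropping the points of zero weight makes all coefficients nonzero; their number
    can only decrease.\<close>
  define Q where "Q = {p\<in>P. u p \<noteq> 0}"
  have Q: "finite Q" "card Q \<le> card P"
    using P(1) by (auto simp: Q_def intro: card_mono)
  obtain h where h: "bij_betw h {1..card Q} Q"
    using ex_bij_betw_nat_finite_1[OF Q(1)] by blast
  show thesis
  proof (rule that[of "card Q" "\<lambda>k. r * u (h k)" h])
    show "inj_on h {1..card Q}"
      using h by (simp add: bij_betw_def)
    show "r * u (h k) \<noteq> 0 \<and> h k extreme_point_of {s. norm s \<le> 1}" if "k \<in> {1..card Q}" for k
      using bij_betwE[OF h] that r P(3) by (auto simp: Q_def B_def)
    have "(\<Sum>k = 1..card Q. (r * u (h k)) *\<^sub>R h k) = (\<Sum>p\<in>Q. (r * u p) *\<^sub>R p)"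
      using sum.reindex_bij_betw[OF h] .
    also have "\<dots> = (\<Sum>p\<in>P. (r * u p) *\<^sub>R p)"
      using P(1) by (intro sum.mono_neutral_left) (auto simp: Q_def)
    also have "\<dots> = s"
      by (simp add: sx u(2)[symmetric] scaleR_sum_right)
    finally show "s = (\<Sum>k = 1..card Q. (r * u (h k)) *\<^sub>R h k)"
      by simp
  qed (use Q cardP in simp)
qed

subsection \<open>Weak-star compactness\<close>

text \<open>Open sets of the pullback are traces of preimages, so an open cover of \<open>S\<close>
  comes from an open cover of its image.\<close>

lemma compactin_pullback_topology:
  assumes "S \<subseteq> A" and "compactin T (f ` S)"
  shows "compactin (pullback_topology A f T) S"
  unfolding compactin_def
proof (intro conjI allI impI)
  show "S \<subseteq> topspace (pullback_topology A f T)"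
    using assms compactin_subset_topspace by (fastforce simp: topspace_pullback_topology)
next
  fix \<U> assume \<U>: "(\<forall>U\<in>\<U>. openin (pullback_topology A f T) U) \<and> S \<subseteq> \<Union>\<U>"
  then obtain V where V: "\<And>U. U \<in> \<U> \<Longrightarrow> openin T (V U) \<and> U = f -` V U \<inter> A"
    unfolding openin_pullback_topology by metis
  then have "f ` S \<subseteq> \<Union>(V ` \<U>)"
    using \<U> by blast
  moreover have "\<forall>U\<in>V ` \<U>. openin T U"
    using V by blast
  ultimately have "\<exists>\<G>. finite \<G> \<and> \<G> \<subseteq> V ` \<U> \<and> f ` S \<subseteq> \<Union>\<G>"
    using assms(2) unfolding compactin_def by blast
  then obtain \<F> where \<F>: "finite \<F>" "\<F> \<subseteq> \<U>" "f ` S \<subseteq> \<Union>(V ` \<F>)"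
    using finite_subset_image by metis
  have "S \<subseteq> \<Union>\<F>"
  proof
    fix x assume "x \<in> S"
    then obtain U where "U \<in> \<F>" "f x \<in> V U"
      using \<F>(3) by blast
    moreover have "U = f -` V U \<inter> A"
      using V \<F>(2) \<open>U \<in> \<F>\<close> by blast
    ultimately show "x \<in> \<Union>\<F>"
      using \<open>x \<in> S\<close> assms(1) by blast
  qed
  then show "\<exists>\<F>. finite \<F> \<and> \<F> \<subseteq> \<U> \<and> S \<subseteq> \<Union>\<F>"
    using \<F> by blast
qed

lemma blinfun_norm_le_iff:
  assumes "0 \<le> b"
  shows "norm s \<le> b \<longleftrightarrow> (\<forall>x. norm (blinfun_apply s x) \<le> norm x * b)"
  using assms by (metis mult.commute norm_blinfun norm_blinfun_bound mult_left_mono norm_ge_zero order_trans)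

text \<open>
  Compactness here is in the product topology of the function space. The sublevel set is cut out of
  a product of intervals by conditions on finitely many coordinates at a time, which are closed.
\<close>

lemma compact_dual_regularized_sublevel:
  fixes \<phi> :: "'a::real_normed_vector ^ 'l" and G :: "real ^ 'l \<Rightarrow> real"
  assumes G: "continuous_on UNIV G" "\<And>u. 0 \<le> G u" and "lam > 0"
  shows "compact (blinfun_apply ` {s. G (dual_measurement \<phi> s) + lam * norm s \<le> c})"
    and "closed (blinfun_apply ` {s. G (dual_measurement \<phi> s) + lam * norm s \<le> c})"
proof -
  define \<Phi> :: "('a \<Rightarrow> real) \<Rightarrow> real ^ 'l" where "\<Phi> f = (\<chi> l. f (\<phi> $ l))" for f
  \<comment> \<open>The operator norm need not be continuous in the product topology, so the
    sublevel condition is solved for the norm and tested pointwise. The condition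
    \<open>G (\<Phi> f) \<le> c\<close> keeps the resulting bound nonnegative.\<close>
  define C where "C = {f::'a \<Rightarrow> real. (\<forall>x y. f (x + y) = f x + f y) \<and> (\<forall>a x. f (a *\<^sub>R x) = a * f x)
    \<and> G (\<Phi> f) \<le> c \<and> (\<forall>x. \<bar>f x\<bar> \<le> norm x * ((c - G (\<Phi> f)) / lam))}"
  have "blinfun_apply ` {s. G (dual_measurement \<phi> s) + lam * norm s \<le> c} = C"
  proof -
    have iff: "blinfun_apply s \<in> C \<longleftrightarrow> G (dual_measurement \<phi> s) + lam * norm s \<le> c" for s
    proof -
      have \<Phi>: "\<Phi> (blinfun_apply s) = dual_measurement \<phi> s"
        by (simp add: \<Phi>_def dual_measurement_def)
      have "G (dual_measurement \<phi> s) + lam * norm s \<le> c \<longleftrightarrow>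
        G (dual_measurement \<phi> s) \<le> c \<and> norm s \<le> (c - G (dual_measurement \<phi> s)) / lam"
        unfolding pos_le_divide_eq[OF \<open>lam > 0\<close>] mult.commute[of "norm s" lam]
        using mult_nonneg_nonneg[OF less_imp_le[OF \<open>lam > 0\<close>] norm_ge_zero[of s]] by linarith
      also have "\<dots> \<longleftrightarrow> blinfun_apply s \<in> C"
        using \<open>lam > 0\<close> blinfun_norm_le_iff[of "(c - G (dual_measurement \<phi> s)) / lam" s]
        by (auto simp: C_def \<Phi> blinfun.add_right blinfun.scaleR_right)
      finally show ?thesis
        by simp
    qed
    moreover have "f \<in> range blinfun_apply" if "f \<in> C" for f
    proof -
      have "bounded_linear f"
        using that
        by (intro bounded_linear_intro[where K = "(c - G (\<Phi> f)) / lam"]) (simp_all add: C_def)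
      then show ?thesis
        by (metis bounded_linear_Blinfun_apply rangeI)
    qed
    ultimately show ?thesis
      by blast
  qed
  moreover have "closed C" "compact C"
  proof -
    have coord: "continuous_on UNIV (\<lambda>f::'a \<Rightarrow> real. f x)" for x
      by simp
    have "continuous_on UNIV \<Phi>"
      unfolding \<Phi>_def by (intro continuous_on_vec_lambda coord)
    then have G\<Phi>: "continuous_on UNIV (\<lambda>f. G (\<Phi> f))"
      by (rule continuous_on_compose2[OF G(1)]) simp
    show "closed C"
      unfolding C_def
      using \<open>lam > 0\<close>
      by (intro closed_Collect_conj closed_Collect_all closed_Collect_eq closed_Collect_le
          continuous_intros coord G\<Phi>) auto
    \<comment> \<open>As \<open>G\<close> is nonnegative, the bound with \<open>c / lam\<close> does
      not depend on \<open>f\<close>, which puts \<open>C\<close> inside a single product of compact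
      intervals.\<close>
    moreover have "C \<subseteq> PiE UNIV (\<lambda>x. cball 0 (norm x * (c / lam)))"
    proof
      fix f assume f: "f \<in> C"
      have "\<bar>f x\<bar> \<le> norm x * (c / lam)" for x
      proof -
        have "norm x * ((c - G (\<Phi> f)) / lam) \<le> norm x * (c / lam)"
          using G(2)[of "\<Phi> f"] \<open>lam > 0\<close> by (intro mult_left_mono divide_right_mono) auto
        then show ?thesis
          using f unfolding C_def by (blast intro: order_trans)
      qed
      then show "f \<in> PiE UNIV (\<lambda>x. cball 0 (norm x * (c / lam)))"
        by auto
    qed
    moreover have "compact (PiE UNIV (\<lambda>x::'a. cball (0::real) (norm x * (c / lam))))"
      using compactin_PiE[of "\<lambda>_. euclidean" UNIV "\<lambda>x::'a. cball (0::real) (norm x * (c / lam))"]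
      by (simp add: euclidean_product_topology)
    ultimately show "compact C"
      by (metis compact_Int_closed inf.absorb2)
  qed
  ultimately show "compact (blinfun_apply ` {s. G (dual_measurement \<phi> s) + lam * norm s \<le> c})"
    and "closed (blinfun_apply ` {s. G (dual_measurement \<phi> s) + lam * norm s \<le> c})"
    by simp_all
qed

lemma compactin_weak_star_regularized_sublevel:
  fixes \<phi> :: "'a::real_normed_vector ^ 'l" and G :: "real ^ 'l \<Rightarrow> real"
  assumes "continuous_on UNIV G" "\<And>u. 0 \<le> G u" and "lam > 0"
  shows "compactin weak_star_topology {s. G (dual_measurement \<phi> s) + lam * norm s \<le> c}"
  unfolding weak_star_topology_def strong_operator_topology_def
  using compact_dual_regularized_sublevel(1)[OF assms, of \<phi> c]
  by (intro compactin_pullback_topology) auto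

text \<open>All sublevel sets \<open>F s \<le> F t\<close> have closed and compact images in the
  function space. Finitely many of them share the best of their \<open>t\<close>, and a common point
  of all of them is a minimizer.\<close>

lemma dual_regularized_minimizer_exists:
  fixes \<phi> :: "'a::real_normed_vector ^ 'l" and G :: "real ^ 'l \<Rightarrow> real"
  assumes "continuous_on UNIV G" "\<And>u. 0 \<le> G u" and "lam > 0"
  obtains s where "\<And>t. G (dual_measurement \<phi> s) + lam * norm s \<le> G (dual_measurement \<phi> t) + lam * norm t"
proof -
  define F where "F s = G (dual_measurement \<phi> s) + lam * norm s" for s
  define C where "C t = blinfun_apply ` {s. F s \<le> F t}" for t
  have C: "compact (C t)" "closed (C t)" for t
    unfolding C_def F_def by (rule compact_dual_regularized_sublevel[OF assms])+
  have "C 0 \<inter> (\<Inter>t\<in>UNIV. C t) \<noteq> {}"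
  proof (rule compact_imp_fip_image[OF C(1)])
    show "closed (C t)" for t
      by (rule C(2))
    fix T :: "('a \<Rightarrow>\<^sub>L real) set" assume "finite T"
    \<comment> \<open>Including \<open>0\<close> makes the set nonempty and places \<open>m\<close>
      in \<open>C 0\<close> as well.\<close>
    define m where "m = arg_min_on F (insert 0 T)"
    have "m \<in> insert 0 T" "\<And>t. t \<in> insert 0 T \<Longrightarrow> F m \<le> F t"
      using \<open>finite T\<close> arg_min_if_finite(1)[of "insert 0 T" F] arg_min_least[of "insert 0 T" _ F]
      by (auto simp: m_def)
    then have "blinfun_apply m \<in> C 0 \<inter> (\<Inter>t\<in>T. C t)"
      by (auto simp: C_def)
    then show "C 0 \<inter> (\<Inter>t\<in>T. C t) \<noteq> {}"
      by blast
  qed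
  then obtain f where f: "\<And>t. f \<in> C t"
    by auto
  then obtain s where s: "f = blinfun_apply s"
    by (auto simp: C_def)
  have "F s \<le> F t" for t
    using f[of t] by (auto simp: C_def s blinfun_apply_inject)
  then show thesis
    using that unfolding F_def by blast
qed

subsection \<open>Elimination of the Hilbert space component\<close>

lemma inner_hilbert_measurement_adjoint:
  "hilbert_measurement_adjoint \<phi> z \<bullet> h = z \<bullet> hilbert_measurement \<phi> h"
  by (simp add: hilbert_measurement_adjoint_def hilbert_measurement_def inner_sum_left inner_vec_def)

lemma linear_dual_measurement: "linear (dual_measurement \<phi>)"
  by (rule linearI) (simp_all add: dual_measurement_def vec_eq_iff blinfun.add_left blinfun.scaleR_left)

lemma linear_hilbert_measurement: "linear (hilbert_measurement \<phi>)"
  by (rule linearI) (simp_all add: hilbert_measurement_def vec_eq_iff inner_add_right)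

lemma linear_hilbert_measurement_adjoint: "linear (hilbert_measurement_adjoint \<phi>)"
  by (rule linearI) (simp_all add: hilbert_measurement_adjoint_def algebra_simps sum.distrib scaleR_sum_right)

lemma regularized_gram_mult:
  assumes "lam \<noteq> 0"
  shows "regularized_gram lam \<phi> *v z
    = z + (1 / lam) *\<^sub>R hilbert_measurement \<phi> (hilbert_measurement_adjoint \<phi> z)"
proof -
  have "(regularized_gram lam \<phi> *v z) $ k
      = (\<Sum>l\<in>UNIV. (1 / lam) * (z $ l * (\<phi> $ k \<bullet> \<phi> $ l)) + (if k = l then z $ l else 0))" for k
    unfolding regularized_gram_def matrix_vector_mult_def mat_def
    using assms by (auto simp: field_simps intro!: sum.cong)
  then show ?thesis
    by (simp add: vec_eq_iff sum.distrib hilbert_measurement_def hilbert_measurement_adjoint_def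
        inner_sum_right sum_distrib_left)
qed

text \<open>Positive definiteness: the quadratic form at \<open>z\<close> is its squared norm plus a
  nonnegative multiple of the squared norm of its adjoint image.\<close>

lemma invertible_regularized_gram:
  assumes "lam > 0"
  shows "invertible (regularized_gram lam \<phi>)"
proof -
  have "z = 0" if "regularized_gram lam \<phi> *v z = 0" for z
  proof -
    let ?a = "hilbert_measurement_adjoint \<phi> z"
    have "z \<bullet> (regularized_gram lam \<phi> *v z) = z \<bullet> z + (1 / lam) * (?a \<bullet> ?a)"
      using assms inner_hilbert_measurement_adjoint[of \<phi> z ?a]
      by (simp add: regularized_gram_mult inner_add_right)
    moreover have "0 \<le> (1 / lam) * (?a \<bullet> ?a)"
      using assms by simp
    ultimately have "z \<bullet> z \<le> 0"
      using that by simp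
    then show ?thesis
      by (metis inner_eq_zero_iff inner_ge_zero order_antisym)
  qed
  then have "inj ((*v) (regularized_gram lam \<phi>))"
    by (subst linear_injective_0) auto
  then show ?thesis
    by (simp add: invertible_left_inverse matrix_left_invertible_injective)
qed

lemma regularized_gram_matrix_inv:
  assumes "lam > 0"
  shows "regularized_gram lam \<phi> *v (matrix_inv (regularized_gram lam \<phi>) *v v) = v"
proof -
  have "regularized_gram lam \<phi> ** matrix_inv (regularized_gram lam \<phi>) = mat 1"
    using invertible_regularized_gram[OF assms, of \<phi>]
    unfolding invertible_def matrix_inv_def by (metis (mono_tags, lifting) someI_ex)
  then show ?thesis
    by (simp add: matrix_vector_mul_assoc)
qed

section \<open>Ridge regression and its optimal value\<close>

definition ridge_dual :: "real \<Rightarrow> 'h::real_inner ^ 'l \<Rightarrow> real ^ 'l \<Rightarrow> real ^ 'l"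
  where "ridge_dual lam \<phi> v = matrix_inv (regularized_gram lam \<phi>) *v v"

definition ridge_solution :: "real \<Rightarrow> 'h::real_inner ^ 'l \<Rightarrow> real ^ 'l \<Rightarrow> 'h"
  where "ridge_solution lam \<phi> v = (1 / lam) *\<^sub>R hilbert_measurement_adjoint \<phi> (ridge_dual lam \<phi> v)"

text \<open>For \<open>lam > 0\<close> this is the minimum of the ridge objective with data
  \<open>v\<close>, written through its residual \<open>ridge_dual\<close> and its minimizer
  \<open>ridge_solution\<close>; see \<open>ridge_residual\<close> and
  \<open>ridge_completed_square\<close>.\<close>

definition ridge_value :: "real \<Rightarrow> 'h::real_inner ^ 'l \<Rightarrow> real ^ 'l \<Rightarrow> real"
  where "ridge_value lam \<phi> v =
    1/2 * (norm (ridge_dual lam \<phi> v))\<^sup>2 + lam / 2 * (norm (ridge_solution lam \<phi> v))\<^sup>2"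

lemma linear_ridge_dual: "linear (ridge_dual lam \<phi>)"
  unfolding ridge_dual_def by (rule matrix_vector_mul_linear)

lemma linear_ridge_solution: "linear (ridge_solution lam \<phi>)"
  by (rule linearI)
    (simp_all add: ridge_solution_def linear_add[OF linear_ridge_dual] linear_cmul[OF linear_ridge_dual]
      linear_add[OF linear_hilbert_measurement_adjoint] linear_cmul[OF linear_hilbert_measurement_adjoint]
      scaleR_right_distrib)

lemma ridge_residual:
  assumes "lam > 0"
  shows "v - hilbert_measurement \<phi> (ridge_solution lam \<phi> v) = ridge_dual lam \<phi> v"
  using regularized_gram_matrix_inv[OF assms, of \<phi> v] assms
  by (simp add: ridge_solution_def ridge_dual_def regularized_gram_mult
      linear_cmul[OF linear_hilbert_measurement] algebra_simps)

text \<open>The normal equation cancels the first-order terms: \<open>lam\<close> times the ridge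
  solution is the adjoint image of the residual, hence
  \<open>lam * (\<sigma> \<bullet> h) = z \<bullet> p\<close>.\<close>

lemma ridge_completed_square:
  assumes "lam > 0"
  shows "1/2 * (norm (v - hilbert_measurement \<phi> s))\<^sup>2 + lam / 2 * (norm s)\<^sup>2
    = ridge_value lam \<phi> v + 1/2 * (norm (hilbert_measurement \<phi> (s - ridge_solution lam \<phi> v)))\<^sup>2
      + lam / 2 * (norm (s - ridge_solution lam \<phi> v))\<^sup>2"
proof -
  define z where "z = ridge_dual lam \<phi> v"
  define \<sigma> where "\<sigma> = ridge_solution lam \<phi> v"
  define h where "h = s - \<sigma>"
  define p where "p = hilbert_measurement \<phi> h"
  have s: "s = \<sigma> + h"
    by (simp add: h_def)
  have res: "v - hilbert_measurement \<phi> s = z - p"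
    using ridge_residual[OF assms, of v \<phi>]
    by (simp add: s p_def z_def \<sigma>_def linear_add[OF linear_hilbert_measurement] algebra_simps)
  have cross: "lam * (\<sigma> \<bullet> h) = z \<bullet> p"
    using assms by (simp add: \<sigma>_def ridge_solution_def z_def p_def inner_hilbert_measurement_adjoint)
  have "1/2 * (norm (z - p))\<^sup>2 + lam / 2 * (norm (\<sigma> + h))\<^sup>2
    = 1/2 * (norm z)\<^sup>2 + lam / 2 * (norm \<sigma>)\<^sup>2 + 1/2 * (norm p)\<^sup>2 + lam / 2 * (norm h)\<^sup>2
      + (lam * (\<sigma> \<bullet> h) - z \<bullet> p)"
    by (simp add: power2_norm_eq_inner inner_add_left inner_add_right inner_diff_left inner_diff_right
        inner_commute algebra_simps)
  then show ?thesis
    unfolding res ridge_value_def \<sigma>_def[symmetric] z_def[symmetric] h_def[symmetric] p_def[symmetric]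
    by (simp only: cross s[symmetric])
qed

text \<open>The parallelogram identity for both norms, composed with linear maps. The subtracted
  term quantifies strict convexity and later yields the uniqueness of \<open>w\<close>.\<close>

lemma ridge_value_midpoint:
  "ridge_value lam \<phi> ((1/2) *\<^sub>R (u + v))
    = (ridge_value lam \<phi> u + ridge_value lam \<phi> v) / 2 - ridge_value lam \<phi> (u - v) / 4"
proof -
  have par: "(norm ((1/2) *\<^sub>R (a + b)))\<^sup>2 = ((norm a)\<^sup>2 + (norm b)\<^sup>2) / 2 - (norm (a - b))\<^sup>2 / 4"
    for a b :: "'x::real_inner"
  proof -
    have "(norm ((1/2) *\<^sub>R (a + b)))\<^sup>2 = (norm (a + b))\<^sup>2 / 4"
      by (simp add: power_divide)
    then show ?thesis
      by (simp add: power2_norm_eq_inner inner_add_left inner_add_right inner_diff_left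
          inner_diff_right inner_commute field_simps)
  qed
  show ?thesis
    unfolding ridge_value_def linear_cmul[OF linear_ridge_dual] linear_add[OF linear_ridge_dual]
      linear_diff[OF linear_ridge_dual] linear_cmul[OF linear_ridge_solution]
      linear_add[OF linear_ridge_solution] linear_diff[OF linear_ridge_solution] par
    by (simp add: algebra_simps add_divide_distrib diff_divide_distrib)
qed

lemma ridge_value_nonneg: "lam > 0 \<Longrightarrow> 0 \<le> ridge_value lam \<phi> v"
  by (simp add: ridge_value_def)

lemma ridge_value_pos:
  assumes "lam > 0" and "v \<noteq> 0"
  shows "0 < ridge_value lam \<phi> v"
proof -
  have "ridge_dual lam \<phi> v \<noteq> 0"
    using regularized_gram_matrix_inv[OF assms(1), of \<phi> v] assms(2) by (auto simp: ridge_dual_def)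
  then show ?thesis
    using assms by (simp add: ridge_value_def add_pos_nonneg)
qed

lemma continuous_on_ridge_value: "continuous_on S (ridge_value lam \<phi>)"
  unfolding ridge_value_def
  by (intro continuous_intros linear_continuous_on linear_conv_bounded_linear[THEN iffD1]
      linear_ridge_dual linear_ridge_solution)

section \<open>The solution set as a norm-minimal slice times a point\<close>

theorem corollary1:
  fixes y :: "real ^ 'l"
    and lam\<^sub>1 lam\<^sub>2 :: real
    and \<phi>\<^sub>1 :: "'a::banach ^ 'l"
    and \<phi>\<^sub>2 :: "'h::{real_inner, complete_space} ^ 'l"
    and W :: "(('a \<Rightarrow>\<^sub>L real) \<times> 'h) set"
  assumes "lam\<^sub>1 > 0" and "lam\<^sub>2 > 0"
  defines "W \<equiv> hybrid_solutions y lam\<^sub>1 lam\<^sub>2 \<phi>\<^sub>1 \<phi>\<^sub>2"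
  shows "W \<noteq> {} \<and> convex W
    \<and> compactin (prod_topology weak_star_topology weak_topology) W
    \<and> (\<exists>w :: real ^ 'l.
        (\<forall>(s\<^sub>1, s\<^sub>2) \<in> W. dual_measurement \<phi>\<^sub>1 s\<^sub>1 = w)
      \<and> (\<forall>s\<^sub>1 s\<^sub>2. (s\<^sub>1, s\<^sub>2) extreme_point_of W \<longrightarrow>
          (\<exists>(K::nat) (\<alpha> :: nat \<Rightarrow> real) (e :: nat \<Rightarrow> 'a \<Rightarrow>\<^sub>L real).
              K \<le> CARD('l)
            \<and> (\<forall>k\<in>{1..K}. \<alpha> k \<noteq> 0 \<and> e k extreme_point_of {s. norm s \<le> 1})
            \<and> inj_on e {1..K}
            \<and> s\<^sub>1 = (\<Sum>k=1..K. \<alpha> k *\<^sub>R e k))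
          \<and> s\<^sub>2 = (1 / lam\<^sub>2) *\<^sub>R hilbert_measurement_adjoint \<phi>\<^sub>2
                    (matrix_inv (regularized_gram lam\<^sub>2 \<phi>\<^sub>2) *v (y - w))))"
proof -
  define Q where "Q = ridge_value lam\<^sub>2 \<phi>\<^sub>2"
  define \<sigma> where "\<sigma> s = ridge_solution lam\<^sub>2 \<phi>\<^sub>2 (y - dual_measurement \<phi>\<^sub>1 s)" for s
  \<comment> \<open>The minimum of the objective over the second variable, attained at
    \<open>\<sigma> s\<close>; see \<open>J_ge\<close> and \<open>J_\<sigma>\<close>.\<close>
  define F where "F s = Q (y - dual_measurement \<phi>\<^sub>1 s) + lam\<^sub>1 * norm s" for s
  let ?J = "hybrid_objective y lam\<^sub>1 lam\<^sub>2 \<phi>\<^sub>1 \<phi>\<^sub>2"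
  note lin = linear_dual_measurement[of \<phi>\<^sub>1]
  have J: "?J (s\<^sub>1, s\<^sub>2) = F s\<^sub>1 + 1/2 * (norm (hilbert_measurement \<phi>\<^sub>2 (s\<^sub>2 - \<sigma> s\<^sub>1)))\<^sup>2
      + lam\<^sub>2 / 2 * (norm (s\<^sub>2 - \<sigma> s\<^sub>1))\<^sup>2" for s\<^sub>1 s\<^sub>2
    using ridge_completed_square[OF \<open>lam\<^sub>2 > 0\<close>, of "y - dual_measurement \<phi>\<^sub>1 s\<^sub>1" \<phi>\<^sub>2 s\<^sub>2]
    by (simp add: hybrid_objective_def F_def Q_def \<sigma>_def diff_diff_eq)
  have J_ge: "F s\<^sub>1 \<le> ?J (s\<^sub>1, s\<^sub>2)" for s\<^sub>1 s\<^sub>2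
    using \<open>lam\<^sub>2 > 0\<close> by (simp add: J)
  have J_\<sigma>: "?J (s\<^sub>1, \<sigma> s\<^sub>1) = F s\<^sub>1" for s\<^sub>1
    by (simp add: J linear_0[OF linear_hilbert_measurement])
  have G: "continuous_on UNIV (\<lambda>u. Q (y - u))" "\<And>u. 0 \<le> Q (y - u)"
    unfolding Q_def using ridge_value_nonneg[OF \<open>lam\<^sub>2 > 0\<close>]
    by (auto intro!: continuous_on_compose2[OF continuous_on_ridge_value[of UNIV]] continuous_intros)
  obtain s\<^sub>0 where s\<^sub>0: "\<And>t. F s\<^sub>0 \<le> F t"
    using dual_regularized_minimizer_exists[OF G \<open>lam\<^sub>1 > 0\<close>, of \<phi>\<^sub>1] unfolding F_def by blast
  have W_iff: "(s\<^sub>1, s\<^sub>2) \<in> W \<longleftrightarrow> F s\<^sub>1 \<le> F s\<^sub>0 \<and> s\<^sub>2 = \<sigma> s\<^sub>1" for s\<^sub>1 s\<^sub>2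
  proof
    assume "(s\<^sub>1, s\<^sub>2) \<in> W"
    then have "?J (s\<^sub>1, s\<^sub>2) \<le> ?J p" for p
      unfolding W_def hybrid_solutions_def is_arg_min_linorder by blast
    then have *: "?J (s\<^sub>1, s\<^sub>2) \<le> F s\<^sub>0" "?J (s\<^sub>1, s\<^sub>2) \<le> F s\<^sub>1"
      by (metis J_\<sigma>)+
    \<comment> \<open>The objective is \<open>F s\<^sub>1\<close> plus two nonnegative squares and
      does not exceed \<open>F s\<^sub>1\<close> here, so the squares must vanish.\<close>
    then have "lam\<^sub>2 / 2 * (norm (s\<^sub>2 - \<sigma> s\<^sub>1))\<^sup>2 \<le> 0"
      using zero_le_power2[of "norm (hilbert_measurement \<phi>\<^sub>2 (s\<^sub>2 - \<sigma> s\<^sub>1))"] unfolding J by linarith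
    then have "s\<^sub>2 = \<sigma> s\<^sub>1"
      using \<open>lam\<^sub>2 > 0\<close> by (simp add: mult_le_0_iff)
    then show "F s\<^sub>1 \<le> F s\<^sub>0 \<and> s\<^sub>2 = \<sigma> s\<^sub>1"
      using * J_\<sigma> by simp
  next
    assume "F s\<^sub>1 \<le> F s\<^sub>0 \<and> s\<^sub>2 = \<sigma> s\<^sub>1"
    then have "?J (s\<^sub>1, s\<^sub>2) \<le> ?J (t\<^sub>1, t\<^sub>2)" for t\<^sub>1 t\<^sub>2
      using J_\<sigma> J_ge s\<^sub>0 order_trans by metis
    then show "(s\<^sub>1, s\<^sub>2) \<in> W"
      by (auto simp: W_def hybrid_solutions_def is_arg_min_linorder)
  qed
  define w where "w = dual_measurement \<phi>\<^sub>1 s\<^sub>0"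
  \<comment> \<open>This is the norm of \<open>s\<^sub>0\<close>. Once the measurement is fixed to
    \<open>w\<close>, \<open>F\<close> depends only on the norm, so minimizing \<open>F\<close>
    means having norm at most \<open>r\<close> in this fibre.\<close>
  define r where "r = (F s\<^sub>0 - Q (y - w)) / lam\<^sub>1"
  \<comment> \<open>For a minimizer with another measurement, the midpoint with
    \<open>s\<^sub>0\<close> would be strictly better: \<open>Q\<close> drops below the average by a
    positive amount, and the norm is convex.\<close>
  have w_unique: "dual_measurement \<phi>\<^sub>1 s = w" if "F s \<le> F s\<^sub>0" for s
  proof (rule ccontr)
    let ?a = "y - dual_measurement \<phi>\<^sub>1 s" and ?m = "(1/2) *\<^sub>R (s + s\<^sub>0)"
    assume "dual_measurement \<phi>\<^sub>1 s \<noteq> w"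
    then have pos: "Q (?a - (y - w)) > 0"
      unfolding Q_def by (intro ridge_value_pos \<open>lam\<^sub>2 > 0\<close>) auto
    have "y - dual_measurement \<phi>\<^sub>1 ?m = (1/2) *\<^sub>R (?a + (y - w))"
      by (simp add: w_def linear_add[OF lin] linear_cmul[OF lin] algebra_simps scaleR_2[symmetric])
    then have "F ?m = (Q ?a + Q (y - w)) / 2 - Q (?a - (y - w)) / 4 + lam\<^sub>1 * norm ?m"
      by (simp only: F_def Q_def ridge_value_midpoint)
    also have "\<dots> < (Q ?a + Q (y - w)) / 2 + lam\<^sub>1 * ((norm s + norm s\<^sub>0) / 2)"
    proof (rule add_less_le_mono)
      show "lam\<^sub>1 * norm ?m \<le> lam\<^sub>1 * ((norm s + norm s\<^sub>0) / 2)"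
        using \<open>lam\<^sub>1 > 0\<close> norm_triangle_ineq[of s s\<^sub>0] by (intro mult_left_mono) auto
    qed (use pos in linarith)
    also have "\<dots> = (F s + F s\<^sub>0) / 2"
      by (simp add: F_def w_def distrib_left add_divide_distrib)
    also have "\<dots> \<le> F s\<^sub>0"
      using that by simp
    finally show False
      using s\<^sub>0[of ?m] by simp
  qed
  define \<sigma>\<^sub>0 where "\<sigma>\<^sub>0 = ridge_solution lam\<^sub>2 \<phi>\<^sub>2 (y - w)"
  define W\<^sub>1 where "W\<^sub>1 = {s. dual_measurement \<phi>\<^sub>1 s = w \<and> norm s \<le> r}"
  have W\<^sub>1: "W\<^sub>1 = {s. F s \<le> F s\<^sub>0}"
  proof -
    have "norm s \<le> r \<longleftrightarrow> F s \<le> F s\<^sub>0" if "dual_measurement \<phi>\<^sub>1 s = w" for s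
      unfolding r_def pos_le_divide_eq[OF \<open>lam\<^sub>1 > 0\<close>] by (simp add: F_def[of s] that) argo
    then show ?thesis
      using w_unique by (auto simp: W\<^sub>1_def)
  qed
  have W: "W = W\<^sub>1 \<times> {\<sigma>\<^sub>0}"
    using W_iff w_unique by (auto simp: W\<^sub>1 \<sigma>_def \<sigma>\<^sub>0_def)
  have "convex W\<^sub>1"
  proof -
    have "W\<^sub>1 = dual_measurement \<phi>\<^sub>1 -` {w} \<inter> cball 0 r"
      by (auto simp: W\<^sub>1_def)
    then show ?thesis
      by (simp add: convex_Int convex_linear_vimage[OF lin])
  qed
  then have convex: "convex W"
    unfolding W by (intro convex_Times) auto
  have nonempty: "W \<noteq> {}"
    using W W\<^sub>1 by auto
  have compact: "compactin (prod_topology weak_star_topology weak_topology) W"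
  proof -
    have "compactin weak_star_topology W\<^sub>1"
      using compactin_weak_star_regularized_sublevel[OF G \<open>lam\<^sub>1 > 0\<close>] by (simp add: W\<^sub>1 F_def)
    moreover have "compactin weak_topology {\<sigma>\<^sub>0}"
      by (intro finite_imp_compactin) (auto simp: weak_topology_def topspace_pullback_topology)
    ultimately show ?thesis
      by (simp add: W compactin_Times)
  qed
  have combination: "\<exists>(K::nat) (\<alpha> :: nat \<Rightarrow> real) (e :: nat \<Rightarrow> 'a \<Rightarrow>\<^sub>L real).
      K \<le> CARD('l) \<and> (\<forall>k\<in>{1..K}. \<alpha> k \<noteq> 0 \<and> e k extreme_point_of {s. norm s \<le> 1})
      \<and> inj_on e {1..K} \<and> s\<^sub>1 = (\<Sum>k=1..K. \<alpha> k *\<^sub>R e k)"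
    if "(s\<^sub>1, s\<^sub>2) extreme_point_of W" for s\<^sub>1 s\<^sub>2
  proof -
    \<comment> \<open>The second factor is a single point, so an open segment between points of
      \<open>W\<^sub>1\<close> lifts to one between points of \<open>W\<close>, and extremality
      passes to the first component.\<close>
    have "s\<^sub>1 extreme_point_of W\<^sub>1"
      unfolding extreme_point_of_def
    proof (intro conjI ballI notI)
      show "s\<^sub>1 \<in> W\<^sub>1"
        using that by (simp add: extreme_point_of_def W)
      fix a b assume ab: "a \<in> W\<^sub>1" "b \<in> W\<^sub>1" "s\<^sub>1 \<in> open_segment a b"
      have "s\<^sub>2 = \<sigma>\<^sub>0"
        using that by (simp add: extreme_point_of_def W)
      with ab have "(s\<^sub>1, s\<^sub>2) \<in> open_segment (a, \<sigma>\<^sub>0) (b, \<sigma>\<^sub>0)"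
        by (auto simp: in_segment scaleR_left_distrib[symmetric])
      moreover have "(a, \<sigma>\<^sub>0) \<in> W" "(b, \<sigma>\<^sub>0) \<in> W"
        using ab by (auto simp: W)
      ultimately show False
        using that unfolding extreme_point_of_def by blast
    qed
    \<comment> \<open>A smaller norm in the fibre over \<open>w\<close> would push \<open>F\<close>
      below its minimum.\<close>
    moreover have "r \<le> norm s" if "dual_measurement \<phi>\<^sub>1 s = w" for s
      using s\<^sub>0[of s] unfolding r_def pos_divide_le_eq[OF \<open>lam\<^sub>1 > 0\<close>]
      by (simp add: F_def[of s] that algebra_simps)
    ultimately show ?thesis
    proof (rule extreme_point_of_minimal_norm_set[OF lin, of s\<^sub>1 w r, folded W\<^sub>1_def])
      fix K :: nat and \<alpha> and e :: "nat \<Rightarrow> 'a \<Rightarrow>\<^sub>L real"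
      assume "K \<le> DIM(real ^ 'l)"
        "\<And>k. k \<in> {1..K} \<Longrightarrow> \<alpha> k \<noteq> 0 \<and> e k extreme_point_of {s. norm s \<le> 1}"
        "inj_on e {1..K}" "s\<^sub>1 = (\<Sum>k=1..K. \<alpha> k *\<^sub>R e k)"
      then show ?thesis
        by (intro exI[of _ K] exI[of _ \<alpha>] exI[of _ e]) simp
    qed
  qed
  have "\<forall>(s\<^sub>1, s\<^sub>2) \<in> W. dual_measurement \<phi>\<^sub>1 s\<^sub>1 = w"
    by (auto simp: W W\<^sub>1_def)
  moreover have "s\<^sub>2 = (1 / lam\<^sub>2) *\<^sub>R hilbert_measurement_adjoint \<phi>\<^sub>2
      (matrix_inv (regularized_gram lam\<^sub>2 \<phi>\<^sub>2) *v (y - w))"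
    if "(s\<^sub>1, s\<^sub>2) extreme_point_of W" for s\<^sub>1 s\<^sub>2
    using that by (simp add: extreme_point_of_def W \<sigma>\<^sub>0_def ridge_solution_def ridge_dual_def)
  ultimately show ?thesis
    by (intro conjI exI[of _ w] allI impI nonempty convex compact combination)
qed

end
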